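(* Let $\mathcal{H}:\mathsf{M}\to\mathsf{N}$ be a functor with right adjoint $\mathcal{K}$, unit $\eta$ and counit $\xi$, let $(\mathcal{C},\delta,\epsilon)$ be a comonad on $\mathsf{M}$, let $\mathcal{C}^{\vee}=\mathcal{H}\mathcal{C}\mathcal{K}$ be the conjugate comonad on $\mathsf{N}$, and let $\gamma=\mathcal{H}\mathcal{C}\eta:\mathcal{H}\mathcal{C}\to\mathcal{C}^{\vee}\mathcal{H}$. Let $\mathcal{D}:\mathsf{N}\to\mathsf{N}$ be a functor and $\sigma:\mathcal{H}\mathcal{C}\to\mathcal{D}\mathcal{H}$ a natural transformation. (i) There is a unique natural transformation $\sigma':\mathcal{C}^{\vee}\to\mathcal{D}$ such that $(\sigma'\mathcal{H})\circ\gamma=\sigma$. (ii) Moreover, if $\mathcal{D}$ is a comonad and $(\mathcal{H},\sigma):(\mathsf{M},\mathcal{C})\to(\mathsf{N},\mathcal{D})$ is a colax morphism of comonads, then $(\mathcal{I},\sigma'):(\mathsf{N},\mathcal{C}^{\vee})\to(\mathsf{N},\mathcal{D})$ is also a colax morphism of comonads.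
   Context: $\mathcal{I}$ denotes the identity functor. The conjugate comonad $\mathcal{C}^{\vee}=\mathcal{H}\mathcal{C}\mathcal{K}$ of $\mathcal{C}$ under the adjunction $(\mathcal{H},\mathcal{K})$ has comultiplication $(\mathcal{H}\mathcal{C}\eta\mathcal{C}\mathcal{K})\circ(\mathcal{H}\delta\mathcal{K}):\mathcal{C}^\vee\to(\mathcal{C}^{\vee})^2$ and counit $\xi\circ(\mathcal{H}\epsilon\mathcal{K}):\mathcal{C}^\vee\to\mathcal{I}$. For comonads $\mathcal{C}$ on $\mathsf{M}$ and $\mathcal{D}$ on $\mathsf{N}$ (with structures both denoted $(\delta,\epsilon)$), a colax morphism of comonads $(\mathcal{H},\sigma):(\mathsf{M},\mathcal{C})\to(\mathsf{N},\mathcal{D})$ consists of a functor $\mathcal{H}:\mathsf{M}\to\mathsf{N}$ and a natural transformation $\sigma:\mathcal{H}\mathcal{C}\to\mathcal{D}\mathcal{H}$ with $(\delta\mathcal{H})\circ\sigma=(\mathcal{D}\sigma)\circ(\sigma\mathcal{C})\circ(\mathcal{H}\delta)$ and $(\epsilon\mathcal{H})\circ\sigma=\mathcal{H}\epsilon$. *)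

theory Defs
  imports Main "HOL-Library.FuncSet"
begin

text \<open>Objects and arrows are carrier sets inside arbitrary types; the operations are only meaningful
  on these carriers. Composition is written in the classical order: \<open>g \<cdot> f\<close> is ``first f, then g''.\<close>

record ('o, 'a) cat =
  obj :: "'o set"
  arr :: "'a set"
  src :: "'a \<Rightarrow> 'o"
  tgt :: "'a \<Rightarrow> 'o"
  ident :: "'o \<Rightarrow> 'a"
  cmp :: "'a \<Rightarrow> 'a \<Rightarrow> 'a" (infixr \<open>\<cdot>\<index>\<close> 70)

definition arrows :: "('o, 'a) cat \<Rightarrow> 'o \<Rightarrow> 'o \<Rightarrow> 'a set" where
  "arrows A X Y = {f \<in> arr A. src A f = X \<and> tgt A f = Y}"

locale category =
  fixes A :: "('o, 'a) cat" (structure)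
  assumes src_obj: "f \<in> arr A \<Longrightarrow> src A f \<in> obj A"
    and tgt_obj: "f \<in> arr A \<Longrightarrow> tgt A f \<in> obj A"
    and ident_arrow: "X \<in> obj A \<Longrightarrow> ident A X \<in> arrows A X X"
    and cmp_arrow: "f \<in> arrows A X Y \<Longrightarrow> g \<in> arrows A Y Z \<Longrightarrow> g \<cdot> f \<in> arrows A X Z"
    and cmp_ident_left: "f \<in> arrows A X Y \<Longrightarrow> ident A Y \<cdot> f = f"
    and cmp_ident_right: "f \<in> arrows A X Y \<Longrightarrow> f \<cdot> ident A X = f"
    and cmp_assoc: "f \<in> arrows A W X \<Longrightarrow> g \<in> arrows A X Y \<Longrightarrow> h \<in> arrows A Y Z \<Longrightarrow>
      (h \<cdot> g) \<cdot> f = h \<cdot> (g \<cdot> f)"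

text \<open>A functor is given by its two maps; their values outside the source category are irrelevant.
  No equation between functors occurs below, so no normalisation of these values is imposed.\<close>

record ('o, 'a, 'p, 'b) ftor =
  fobj :: "'o \<Rightarrow> 'p"
  farr :: "'a \<Rightarrow> 'b"

locale is_functor = source: category A + target: category B
  for A :: "('o, 'a) cat" and B :: "('p, 'b) cat" +
  fixes F :: "('o, 'a, 'p, 'b) ftor"
  assumes fobj_obj: "X \<in> obj A \<Longrightarrow> fobj F X \<in> obj B"
    and farr_arrow: "f \<in> arrows A X Y \<Longrightarrow> farr F f \<in> arrows B (fobj F X) (fobj F Y)"
    and farr_ident: "X \<in> obj A \<Longrightarrow> farr F (ident A X) = ident B (fobj F X)"
    and farr_cmp: "f \<in> arrows A X Y \<Longrightarrow> g \<in> arrows A Y Z \<Longrightarrow>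
      farr F (g \<cdot>\<^bsub>A\<^esub> f) = farr F g \<cdot>\<^bsub>B\<^esub> farr F f"

definition id_ftor :: "('o, 'a, 'o, 'a) ftor" where
  "id_ftor = \<lparr>fobj = id, farr = id\<rparr>"

definition ftor_comp ::
    "('p, 'b, 'q, 'c) ftor \<Rightarrow> ('o, 'a, 'p, 'b) ftor \<Rightarrow> ('o, 'a, 'q, 'c) ftor" (infixr \<open>\<circ>\<^sub>F\<close> 75) where
  "G \<circ>\<^sub>F F = \<lparr>fobj = fobj G \<circ> fobj F, farr = farr G \<circ> farr F\<rparr>"

text \<open>A natural transformation is its family of components. It is required to be \<open>undefined\<close> outside
  the objects of the source category, so that equality in HOL is equality of natural
  transformations; correspondingly, all operations below restrict to these objects.\<close>

locale nat_trans = dom_functor: is_functor A B F + cod_functor: is_functor A B G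
  for A :: "('o, 'a) cat" and B :: "('p, 'b) cat"
    and F :: "('o, 'a, 'p, 'b) ftor" and G :: "('o, 'a, 'p, 'b) ftor" +
  fixes \<tau> :: "'o \<Rightarrow> 'b"
  assumes component: "X \<in> obj A \<Longrightarrow> \<tau> X \<in> arrows B (fobj F X) (fobj G X)"
    and natural: "f \<in> arrows A X Y \<Longrightarrow> farr G f \<cdot>\<^bsub>B\<^esub> \<tau> X = \<tau> Y \<cdot>\<^bsub>B\<^esub> farr F f"
    and extensional: "\<tau> \<in> extensional (obj A)"

definition id_trans :: "('o, 'a) cat \<Rightarrow> ('p, 'b) cat \<Rightarrow> ('o, 'a, 'p, 'b) ftor \<Rightarrow> 'o \<Rightarrow> 'b" where
  "id_trans A B F = (\<lambda>X\<in>obj A. ident B (fobj F X))"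

definition vcomp ::
    "('o, 'a) cat \<Rightarrow> ('p, 'b) cat \<Rightarrow> ('o \<Rightarrow> 'b) \<Rightarrow> ('o \<Rightarrow> 'b) \<Rightarrow> 'o \<Rightarrow> 'b" where
  "vcomp A B \<tau> \<sigma> = (\<lambda>X\<in>obj A. \<tau> X \<cdot>\<^bsub>B\<^esub> \<sigma> X)"

text \<open>Whiskering: \<open>whisker_left A F \<tau>\<close> is \<open>F\<tau>\<close> and \<open>whisker_right A \<tau> F\<close> is \<open>\<tau>F\<close>, where
  \<open>A\<close> is in both cases the source category of the resulting transformation.\<close>

definition whisker_left ::
    "('o, 'a) cat \<Rightarrow> ('p, 'b, 'q, 'c) ftor \<Rightarrow> ('o \<Rightarrow> 'b) \<Rightarrow> 'o \<Rightarrow> 'c" where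
  "whisker_left A F \<tau> = (\<lambda>X\<in>obj A. farr F (\<tau> X))"

definition whisker_right ::
    "('o, 'a) cat \<Rightarrow> ('p \<Rightarrow> 'c) \<Rightarrow> ('o, 'a, 'p, 'b) ftor \<Rightarrow> 'o \<Rightarrow> 'c" where
  "whisker_right A \<tau> F = (\<lambda>X\<in>obj A. \<tau> (fobj F X))"

locale adjunction =
  left: is_functor M N H + right: is_functor N M K +
  unit: nat_trans M M id_ftor "K \<circ>\<^sub>F H" \<eta> + counit: nat_trans N N "H \<circ>\<^sub>F K" id_ftor \<xi>
  for M :: "('o, 'a) cat" and N :: "('p, 'b) cat"
    and H :: "('o, 'a, 'p, 'b) ftor" and K :: "('p, 'b, 'o, 'a) ftor"
    and \<eta> :: "'o \<Rightarrow> 'a" and \<xi> :: "'p \<Rightarrow> 'b" +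
  assumes triangle_left:
      "vcomp M N (whisker_right M \<xi> H) (whisker_left M H \<eta>) = id_trans M N H"
    and triangle_right:
      "vcomp N M (whisker_left N K \<xi>) (whisker_right N \<eta> K) = id_trans N M K"

locale comonad =
  endo: is_functor M M C +
  comult: nat_trans M M C "C \<circ>\<^sub>F C" \<delta> + counit: nat_trans M M C id_ftor \<epsilon>
  for M :: "('o, 'a) cat" and C :: "('o, 'a, 'o, 'a) ftor"
    and \<delta> :: "'o \<Rightarrow> 'a" and \<epsilon> :: "'o \<Rightarrow> 'a" +
  assumes coassoc: "vcomp M M (whisker_right M \<delta> C) \<delta> = vcomp M M (whisker_left M C \<delta>) \<delta>"
    and counit_left: "vcomp M M (whisker_right M \<epsilon> C) \<delta> = id_trans M M C"
    and counit_right: "vcomp M M (whisker_left M C \<epsilon>) \<delta> = id_trans M M C"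

locale colax_morphism =
  source: comonad M C \<delta> \<epsilon> + target: comonad N D \<delta>' \<epsilon>' +
  carrier: is_functor M N H + trans: nat_trans M N "H \<circ>\<^sub>F C" "D \<circ>\<^sub>F H" \<sigma>
  for M :: "('o, 'a) cat" and C :: "('o, 'a, 'o, 'a) ftor" and \<delta> \<epsilon> :: "'o \<Rightarrow> 'a"
    and N :: "('p, 'b) cat" and D :: "('p, 'b, 'p, 'b) ftor" and \<delta>' \<epsilon>' :: "'p \<Rightarrow> 'b"
    and H :: "('o, 'a, 'p, 'b) ftor" and \<sigma> :: "'o \<Rightarrow> 'b" +
  assumes comult_compat:
      "vcomp M N (whisker_right M \<delta>' H) \<sigma> =
       vcomp M N (whisker_left M D \<sigma>) (vcomp M N (whisker_right M \<sigma> C) (whisker_left M H \<delta>))"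
    and counit_compat: "vcomp M N (whisker_right M \<epsilon>' H) \<sigma> = whisker_left M H \<epsilon>"

definition conj_ftor ::
    "('o, 'a, 'p, 'b) ftor \<Rightarrow> ('p, 'b, 'o, 'a) ftor \<Rightarrow> ('o, 'a, 'o, 'a) ftor \<Rightarrow> ('p, 'b, 'p, 'b) ftor" where
  "conj_ftor H K C = H \<circ>\<^sub>F C \<circ>\<^sub>F K"

definition conj_comult ::
    "('p, 'b) cat \<Rightarrow> ('o, 'a, 'p, 'b) ftor \<Rightarrow> ('p, 'b, 'o, 'a) ftor \<Rightarrow> ('o \<Rightarrow> 'a) \<Rightarrow>
     ('o, 'a, 'o, 'a) ftor \<Rightarrow> ('o \<Rightarrow> 'a) \<Rightarrow> 'p \<Rightarrow> 'b" where
  "conj_comult N H K \<eta> C \<delta> =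
     vcomp N N (whisker_left N (H \<circ>\<^sub>F C) (whisker_right N \<eta> (C \<circ>\<^sub>F K)))
       (whisker_left N H (whisker_right N \<delta> K))"

definition conj_counit ::
    "('p, 'b) cat \<Rightarrow> ('o, 'a, 'p, 'b) ftor \<Rightarrow> ('p, 'b, 'o, 'a) ftor \<Rightarrow> ('p \<Rightarrow> 'b) \<Rightarrow>
     ('o \<Rightarrow> 'a) \<Rightarrow> 'p \<Rightarrow> 'b" where
  "conj_counit N H K \<xi> \<epsilon> = vcomp N N \<xi> (whisker_left N H (whisker_right N \<epsilon> K))"

text \<open>The canonical transformation \<open>\<gamma> = HC\<eta>\<close> from \<open>HC\<close> to \<open>(HCK)H\<close>.\<close>

definition conj_gamma ::
    "('o, 'a) cat \<Rightarrow> ('o, 'a, 'p, 'b) ftor \<Rightarrow> ('o \<Rightarrow> 'a) \<Rightarrow> ('o, 'a, 'o, 'a) ftor \<Rightarrow> 'o \<Rightarrow> 'b" where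
  "conj_gamma M H \<eta> C = whisker_left M (H \<circ>\<^sub>F C) \<eta>"

end

theory Submission
  imports Defs
begin

text \<open>
  A transformation out of the conjugate comonad \<open>HCK\<close> is the same thing as a transformation
  \<open>HC \<rightarrow> DH\<close>: precomposition with \<open>K\<close> is left adjoint to precomposition with \<open>H\<close>, so that
  transformations \<open>FK \<rightarrow> D\<close> correspond to transformations \<open>F \<rightarrow> DH\<close> for every functor \<open>F\<close>, here
  \<open>F = HC\<close>. Explicitly, \<open>\<sigma>\<close> has the mate \<open>D\<xi> \<circ> \<sigma>K\<close>, and \<open>\<sigma>'\<close> is recovered from
  \<open>\<sigma> = \<sigma>'H \<circ> F\<eta>\<close> because naturality of \<open>\<sigma>'\<close> at \<open>\<xi>\<close> followed by the triangle identity for \<open>K\<close>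
  turns \<open>D\<xi> \<circ> \<sigma>K\<close> into \<open>\<sigma>'\<close> (\<open>mate_unique\<close>), while the triangle identity for \<open>H\<close> gives the
  other composite (\<open>mate_factorises\<close>).

  For the second part, the colax equations for \<open>\<sigma>'\<close> are those for \<open>\<sigma>\<close> at the objects \<open>KY\<close>, pushed
  forward along \<open>\<xi>\<^sub>Y\<close>. In the counit equation \<open>\<xi>\<^sub>Y\<close> slides past \<open>\<epsilon>'\<close> by naturality. In the
  comultiplication equation it slides past \<open>\<delta>'\<close>, and the unit occurring in the comultiplication of
  \<open>HCK\<close> is absorbed by \<open>\<sigma>'H \<circ> HC\<eta> = \<sigma>\<close>. The notion of a colax morphism includes that \<open>HCK\<close> is a
  comonad (\<open>comonad_conj\<close>): in its laws the units coming from the comultiplication slide by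
  naturality to places where they are common to both sides or cancel against \<open>\<xi>\<close> by a triangle
  identity, and what remains are the laws of \<open>C\<close>.
\<close>

section \<open>Calculating with composable arrows\<close>

text \<open>Composability expressed by equations between sources and targets, instead of by membership in
  sets \<open>arrows A X Y\<close>, leaves no free object variables in the premises; the simplifier can then
  type-check and reassociate composites by itself.\<close>

lemma arrows_iff: "f \<in> arrows A X Y \<longleftrightarrow> f \<in> arr A \<and> src A f = X \<and> tgt A f = Y"
  by (simp add: arrows_def)

lemma (in category) cmp_arr:
  assumes "f \<in> arr A" "g \<in> arr A" "src A g = tgt A f"
  shows "g \<cdot> f \<in> arr A" "src A (g \<cdot> f) = src A f" "tgt A (g \<cdot> f) = tgt A g"
  using cmp_arrow[of f "src A f" "tgt A f" g "tgt A g"] assms by (auto simp: arrows_iff)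

lemma (in category) cmp_assoc_arr:
  assumes "f \<in> arr A" "g \<in> arr A" "h \<in> arr A" "src A g = tgt A f" "src A h = tgt A g"
  shows "(h \<cdot> g) \<cdot> f = h \<cdot> (g \<cdot> f)"
  using cmp_assoc[of f "src A f" "tgt A f" g "tgt A g" h "tgt A h"] assms by (auto simp: arrows_iff)

lemma (in category) ident_arr:
  assumes "X \<in> obj A"
  shows "ident A X \<in> arr A" "src A (ident A X) = X" "tgt A (ident A X) = X"
  using ident_arrow[OF assms] by (auto simp: arrows_iff)

lemma (in category) cmp_ident_arr:
  assumes "f \<in> arr A"
  shows "src A f = X \<Longrightarrow> f \<cdot> ident A X = f" "tgt A f = X \<Longrightarrow> ident A X \<cdot> f = f"
  using assms cmp_ident_left[of f "src A f" "tgt A f"] cmp_ident_right[of f "src A f" "tgt A f"]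
  by (auto simp: arrows_iff)

lemmas (in category) arr_simps =
  src_obj tgt_obj cmp_arr cmp_assoc_arr ident_arr cmp_ident_arr

lemma (in is_functor) farr_arr:
  assumes "f \<in> arr A"
  shows "farr F f \<in> arr B" "src B (farr F f) = fobj F (src A f)"
    "tgt B (farr F f) = fobj F (tgt A f)"
  using farr_arrow[of f "src A f" "tgt A f"] assms by (auto simp: arrows_iff)

lemma (in is_functor) farr_cmp_arr:
  assumes "f \<in> arr A" "g \<in> arr A" "src A g = tgt A f"
  shows "farr F (g \<cdot>\<^bsub>A\<^esub> f) = farr F g \<cdot>\<^bsub>B\<^esub> farr F f"
  using farr_cmp[of f "src A f" "tgt A f" g "tgt A g"] assms by (auto simp: arrows_iff)

lemmas (in is_functor) ftor_simps = fobj_obj farr_arr farr_ident farr_cmp_arr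

lemma (in nat_trans) component_arr:
  assumes "X \<in> obj A"
  shows "\<tau> X \<in> arr B" "src B (\<tau> X) = fobj F X" "tgt B (\<tau> X) = fobj G X"
  using component[OF assms] by (auto simp: arrows_iff)

lemma (in nat_trans) natural_arr:
  assumes "f \<in> arr A"
  shows "farr G f \<cdot>\<^bsub>B\<^esub> \<tau> (src A f) = \<tau> (tgt A f) \<cdot>\<^bsub>B\<^esub> farr F f"
  using natural[of f "src A f" "tgt A f"] assms by (auto simp: arrows_iff)

section \<open>Functors and whiskering\<close>

lemma ftor_comp_apply [simp]:
  "fobj (G \<circ>\<^sub>F F) X = fobj G (fobj F X)" "farr (G \<circ>\<^sub>F F) f = farr G (farr F f)"
  by (simp_all add: ftor_comp_def)

lemma id_ftor_apply [simp]: "fobj id_ftor X = X" "farr id_ftor f = f"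
  by (simp_all add: id_ftor_def)

lemma ftor_comp_assoc: "(G \<circ>\<^sub>F F) \<circ>\<^sub>F E = G \<circ>\<^sub>F (F \<circ>\<^sub>F E)"
  by (simp add: ftor_comp_def comp_assoc)

lemma ftor_comp_id [simp]: "id_ftor \<circ>\<^sub>F F = F" "F \<circ>\<^sub>F id_ftor = F"
  by (simp_all add: ftor_comp_def id_ftor_def)

lemma is_functor_id: "category A \<Longrightarrow> is_functor A A id_ftor"
  by (simp add: is_functor_def is_functor_axioms_def)

lemma is_functor_comp:
  assumes "is_functor A B F" "is_functor B E G"
  shows "is_functor A E (G \<circ>\<^sub>F F)"
proof -
  interpret F: is_functor A B F by fact
  interpret G: is_functor B E G by fact
  show ?thesis
    by unfold_locales
      (auto simp: F.ftor_simps G.ftor_simps F.farr_cmp F.farr_arrow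
        intro: F.farr_arrow G.farr_arrow G.farr_cmp)
qed

lemma nat_trans_vcomp:
  assumes "nat_trans A B F G \<sigma>" "nat_trans A B G E \<tau>"
  shows "nat_trans A B F E (vcomp A B \<tau> \<sigma>)"
proof -
  interpret s: nat_trans A B F G \<sigma> by fact
  interpret t: nat_trans A B G E \<tau> by fact
  note simps = s.dom_functor.source.arr_simps s.dom_functor.target.arr_simps
    s.dom_functor.ftor_simps s.cod_functor.ftor_simps t.cod_functor.ftor_simps
    s.component_arr t.component_arr
  show ?thesis
  proof unfold_locales
    fix X assume "X \<in> obj A"
    then show "vcomp A B \<tau> \<sigma> X \<in> arrows B (fobj F X) (fobj E X)"
      by (simp add: vcomp_def arrows_iff simps)
  next
    fix f X Y assume f: "f \<in> arrows A X Y"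
    then have [simp]: "f \<in> arr A" "src A f = X" "tgt A f = Y" "X \<in> obj A" "Y \<in> obj A"
      by (auto simp: arrows_iff simps)
    have "farr E f \<cdot>\<^bsub>B\<^esub> \<tau> X \<cdot>\<^bsub>B\<^esub> \<sigma> X = (farr E f \<cdot>\<^bsub>B\<^esub> \<tau> X) \<cdot>\<^bsub>B\<^esub> \<sigma> X"
      by (simp add: simps)
    also have "\<dots> = \<tau> Y \<cdot>\<^bsub>B\<^esub> farr G f \<cdot>\<^bsub>B\<^esub> \<sigma> X"
      by (simp add: t.natural[OF f] simps)
    also have "\<dots> = (\<tau> Y \<cdot>\<^bsub>B\<^esub> \<sigma> Y) \<cdot>\<^bsub>B\<^esub> farr F f"
      by (simp add: s.natural[OF f] simps)
    finally show "farr E f \<cdot>\<^bsub>B\<^esub> vcomp A B \<tau> \<sigma> X = vcomp A B \<tau> \<sigma> Y \<cdot>\<^bsub>B\<^esub> farr F f"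
      by (simp add: vcomp_def)
  qed (simp add: vcomp_def)
qed

lemma nat_trans_whisker_left:
  assumes "nat_trans A B F G \<tau>" "is_functor B E L"
  shows "nat_trans A E (L \<circ>\<^sub>F F) (L \<circ>\<^sub>F G) (whisker_left A L \<tau>)"
proof -
  interpret t: nat_trans A B F G \<tau> by fact
  interpret L: is_functor B E L by fact
  interpret LF: is_functor A E "L \<circ>\<^sub>F F"
    by (rule is_functor_comp[OF t.dom_functor.is_functor_axioms L.is_functor_axioms])
  interpret LG: is_functor A E "L \<circ>\<^sub>F G"
    by (rule is_functor_comp[OF t.cod_functor.is_functor_axioms L.is_functor_axioms])
  show ?thesis
  proof unfold_locales
    fix X assume "X \<in> obj A"
    then show "whisker_left A L \<tau> X \<in> arrows E (fobj (L \<circ>\<^sub>F F) X) (fobj (L \<circ>\<^sub>F G) X)"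
      by (simp add: whisker_left_def L.farr_arrow t.component)
  next
    fix f X Y assume f: "f \<in> arrows A X Y"
    then have X: "X \<in> obj A" and Y: "Y \<in> obj A"
      by (auto simp: arrows_iff t.dom_functor.source.arr_simps)
    have "farr L (farr G f) \<cdot>\<^bsub>E\<^esub> farr L (\<tau> X) = farr L (farr G f \<cdot>\<^bsub>B\<^esub> \<tau> X)"
      by (rule L.farr_cmp[OF t.component[OF X] t.cod_functor.farr_arrow[OF f], symmetric])
    also have "\<dots> = farr L (\<tau> Y \<cdot>\<^bsub>B\<^esub> farr F f)"
      by (simp add: t.natural[OF f])
    also have "\<dots> = farr L (\<tau> Y) \<cdot>\<^bsub>E\<^esub> farr L (farr F f)"
      by (rule L.farr_cmp[OF t.dom_functor.farr_arrow[OF f] t.component[OF Y]])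
    finally show "farr (L \<circ>\<^sub>F G) f \<cdot>\<^bsub>E\<^esub> whisker_left A L \<tau> X
        = whisker_left A L \<tau> Y \<cdot>\<^bsub>E\<^esub> farr (L \<circ>\<^sub>F F) f"
      by (simp add: whisker_left_def X Y)
  qed (simp add: whisker_left_def)
qed

lemma nat_trans_whisker_right:
  assumes "is_functor A B L" "nat_trans B E F G \<tau>"
  shows "nat_trans A E (F \<circ>\<^sub>F L) (G \<circ>\<^sub>F L) (whisker_right A \<tau> L)"
proof -
  interpret L: is_functor A B L by fact
  interpret t: nat_trans B E F G \<tau> by fact
  interpret FL: is_functor A E "F \<circ>\<^sub>F L"
    by (rule is_functor_comp[OF L.is_functor_axioms t.dom_functor.is_functor_axioms])
  interpret GL: is_functor A E "G \<circ>\<^sub>F L"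
    by (rule is_functor_comp[OF L.is_functor_axioms t.cod_functor.is_functor_axioms])
  show ?thesis
  proof unfold_locales
    fix X assume "X \<in> obj A"
    then show "whisker_right A \<tau> L X \<in> arrows E (fobj (F \<circ>\<^sub>F L) X) (fobj (G \<circ>\<^sub>F L) X)"
      by (simp add: whisker_right_def L.fobj_obj t.component)
  next
    fix f X Y assume f: "f \<in> arrows A X Y"
    then have "X \<in> obj A" "Y \<in> obj A"
      by (auto simp: arrows_iff L.source.arr_simps)
    then show "farr (G \<circ>\<^sub>F L) f \<cdot>\<^bsub>E\<^esub> whisker_right A \<tau> L X
        = whisker_right A \<tau> L Y \<cdot>\<^bsub>E\<^esub> farr (F \<circ>\<^sub>F L) f"
      by (simp add: whisker_right_def t.natural[OF L.farr_arrow[OF f]])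
  qed (simp add: whisker_right_def)
qed

section \<open>Mates along an adjunction\<close>

context adjunction
begin

lemma triangle_left_at:
  assumes "X \<in> obj M"
  shows "\<xi> (fobj H X) \<cdot>\<^bsub>N\<^esub> farr H (\<eta> X) = ident N (fobj H X)"
  using fun_cong[OF triangle_left, of X] assms
  by (simp add: vcomp_def whisker_right_def whisker_left_def id_trans_def)

lemma triangle_right_at:
  assumes "Y \<in> obj N"
  shows "farr K (\<xi> Y) \<cdot>\<^bsub>M\<^esub> \<eta> (fobj K Y) = ident M (fobj K Y)"
  using fun_cong[OF triangle_right, of Y] assms
  by (simp add: vcomp_def whisker_right_def whisker_left_def id_trans_def)

lemma unit_natural:
  assumes "f \<in> arrows M X Y"
  shows "farr K (farr H f) \<cdot>\<^bsub>M\<^esub> \<eta> X = \<eta> Y \<cdot>\<^bsub>M\<^esub> f"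
  using unit.natural[OF assms] by simp

lemma counit_natural:
  assumes "f \<in> arrows N X Y"
  shows "f \<cdot>\<^bsub>N\<^esub> \<xi> X = \<xi> Y \<cdot>\<^bsub>N\<^esub> farr H (farr K f)"
  using counit.natural[OF assms] by simp

lemmas adj_simps =
  left.source.arr_simps left.target.arr_simps left.ftor_simps right.ftor_simps
  unit.component_arr counit.component_arr

definition mate :: "('p, 'b, 'q, 'c) ftor \<Rightarrow> ('q, 'c) cat \<Rightarrow> ('o \<Rightarrow> 'c) \<Rightarrow> 'p \<Rightarrow> 'c" where
  "mate D E \<sigma> = vcomp N E (whisker_left N D \<xi>) (whisker_right N \<sigma> K)"

lemma mate_at: "Y \<in> obj N \<Longrightarrow> mate D E \<sigma> Y = farr D (\<xi> Y) \<cdot>\<^bsub>E\<^esub> \<sigma> (fobj K Y)"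
  by (simp add: mate_def vcomp_def whisker_left_def whisker_right_def)

lemma nat_trans_mate:
  assumes "nat_trans M E F (D \<circ>\<^sub>F H) \<sigma>" "is_functor N E D"
  shows "nat_trans N E (F \<circ>\<^sub>F K) D (mate D E \<sigma>)"
proof -
  have "nat_trans N E (F \<circ>\<^sub>F K) (D \<circ>\<^sub>F H \<circ>\<^sub>F K) (whisker_right N \<sigma> K)"
    using nat_trans_whisker_right[OF right.is_functor_axioms assms(1)]
    by (simp add: ftor_comp_assoc)
  moreover have "nat_trans N E (D \<circ>\<^sub>F H \<circ>\<^sub>F K) D (whisker_left N D \<xi>)"
    using nat_trans_whisker_left[OF counit.nat_trans_axioms assms(2)] by simp
  ultimately show ?thesis
    unfolding mate_def by (rule nat_trans_vcomp)
qed

text \<open>Sliding \<open>\<eta>\<close> past \<open>\<sigma>\<close> by naturality brings it next to \<open>\<xi>\<close>, where the triangle identity for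
  \<open>H\<close>, under \<open>D\<close>, cancels the two.\<close>

lemma mate_factorises:
  assumes "nat_trans M E F (D \<circ>\<^sub>F H) \<sigma>" "is_functor N E D"
  shows "vcomp M E (whisker_right M (mate D E \<sigma>) H) (whisker_left M F \<eta>) = \<sigma>"
proof
  interpret s: nat_trans M E F "D \<circ>\<^sub>F H" \<sigma> by fact
  interpret D: is_functor N E D by fact
  note simps = adj_simps s.dom_functor.target.arr_simps D.farr_arr D.fobj_obj s.dom_functor.farr_arr
    s.dom_functor.fobj_obj s.component_arr
  fix X
  show "vcomp M E (whisker_right M (mate D E \<sigma>) H) (whisker_left M F \<eta>) X = \<sigma> X"
  proof (cases "X \<in> obj M")
    case True
    then have [simp]: "X \<in> obj M" .
    have "mate D E \<sigma> (fobj H X) \<cdot>\<^bsub>E\<^esub> farr F (\<eta> X)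
        = farr D (\<xi> (fobj H X)) \<cdot>\<^bsub>E\<^esub> \<sigma> (fobj K (fobj H X)) \<cdot>\<^bsub>E\<^esub> farr F (\<eta> X)"
      by (simp add: mate_at simps)
    also have "\<dots> = farr D (\<xi> (fobj H X)) \<cdot>\<^bsub>E\<^esub> farr D (farr H (\<eta> X)) \<cdot>\<^bsub>E\<^esub> \<sigma> X"
      using s.natural_arr[of "\<eta> X"] by (simp add: simps)
    also have "\<dots> = farr D (\<xi> (fobj H X) \<cdot>\<^bsub>N\<^esub> farr H (\<eta> X)) \<cdot>\<^bsub>E\<^esub> \<sigma> X"
      by (simp add: simps D.farr_cmp_arr)
    also have "\<dots> = \<sigma> X"
      by (simp add: triangle_left_at simps D.farr_ident)
    finally show ?thesis
      by (simp add: vcomp_def whisker_left_def whisker_right_def)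
  next
    case False
    then show ?thesis
      using extensional_arb[OF s.extensional] by (simp add: vcomp_def)
  qed
qed

text \<open>By naturality of \<open>\<tau>\<close> at \<open>\<xi>\<^sub>Y\<close>, the mate of \<open>\<tau>H \<circ> F\<eta>\<close> at \<open>Y\<close> is \<open>\<tau>\<^sub>Y\<close> preceded by
  \<open>F(K\<xi>\<^sub>Y \<circ> \<eta>\<^sub>K\<^sub>Y)\<close>, which is an identity.\<close>

lemma mate_unique:
  assumes "is_functor M E F" "nat_trans N E (F \<circ>\<^sub>F K) D \<tau>"
    and fact: "vcomp M E (whisker_right M \<tau> H) (whisker_left M F \<eta>) = \<sigma>"
  shows "\<tau> = mate D E \<sigma>"
proof
  interpret F: is_functor M E F by fact
  interpret t: nat_trans N E "F \<circ>\<^sub>F K" D \<tau> by fact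
  note simps = adj_simps F.target.arr_simps F.farr_arr F.fobj_obj t.cod_functor.farr_arr
    t.cod_functor.fobj_obj t.component_arr
  fix Y
  show "\<tau> Y = mate D E \<sigma> Y"
  proof (cases "Y \<in> obj N")
    case True
    then have [simp]: "Y \<in> obj N" .
    have "mate D E \<sigma> Y
        = (farr D (\<xi> Y) \<cdot>\<^bsub>E\<^esub> \<tau> (fobj H (fobj K Y))) \<cdot>\<^bsub>E\<^esub> farr F (\<eta> (fobj K Y))"
      by (simp add: mate_at vcomp_def whisker_left_def whisker_right_def simps flip: fact)
    also have "\<dots> = (\<tau> Y \<cdot>\<^bsub>E\<^esub> farr F (farr K (\<xi> Y))) \<cdot>\<^bsub>E\<^esub> farr F (\<eta> (fobj K Y))"
      using t.natural_arr[of "\<xi> Y"] by (simp add: counit.component_arr)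
    also have "\<dots> = \<tau> Y \<cdot>\<^bsub>E\<^esub> farr F (farr K (\<xi> Y) \<cdot>\<^bsub>M\<^esub> \<eta> (fobj K Y))"
      by (simp add: simps F.farr_cmp_arr)
    also have "\<dots> = \<tau> Y"
      by (simp add: triangle_right_at simps F.farr_ident)
    finally show ?thesis ..
  next
    case False
    then show ?thesis
      using extensional_arb[OF t.extensional] by (simp add: mate_def vcomp_def)
  qed
qed

end

section \<open>The conjugate comonad\<close>

locale adjunction_comonad =
  adj: adjunction M N H K \<eta> \<xi> + com: comonad M C \<delta> \<epsilon>
  for M :: "('o, 'a) cat" and N :: "('p, 'b) cat"
    and H :: "('o, 'a, 'p, 'b) ftor" and K :: "('p, 'b, 'o, 'a) ftor"
    and \<eta> :: "'o \<Rightarrow> 'a" and \<xi> :: "'p \<Rightarrow> 'b"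
    and C :: "('o, 'a, 'o, 'a) ftor" and \<delta> \<epsilon> :: "'o \<Rightarrow> 'a"
begin

lemmas simps = adj.adj_simps com.endo.ftor_simps com.comult.component_arr
  com.counit.component_arr

abbreviation "C' \<equiv> conj_ftor H K C"
abbreviation "\<delta>\<^sub>C \<equiv> conj_comult N H K \<eta> C \<delta>"
abbreviation "\<epsilon>\<^sub>C \<equiv> conj_counit N H K \<xi> \<epsilon>"

text \<open>The comultiplication of the conjugate comonad is the image under \<open>H\<close> of a transformation
  \<open>CK \<rightarrow> CKHCK\<close>, so its laws can be checked in \<open>M\<close>.\<close>

definition pre_comult :: "'p \<Rightarrow> 'a" where
  "pre_comult Y = farr C (\<eta> (fobj C (fobj K Y))) \<cdot>\<^bsub>M\<^esub> \<delta> (fobj K Y)"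

lemma pre_comult_arrow:
  "Y \<in> obj N \<Longrightarrow>
     pre_comult Y \<in> arrows M (fobj C (fobj K Y)) (fobj C (fobj K (fobj C' Y)))"
  by (simp add: pre_comult_def arrows_iff simps conj_ftor_def)

lemma conj_comult_at: "Y \<in> obj N \<Longrightarrow> \<delta>\<^sub>C Y = farr H (pre_comult Y)"
  by (simp add: conj_comult_def pre_comult_def vcomp_def whisker_left_def whisker_right_def simps)

lemma conj_counit_at: "Y \<in> obj N \<Longrightarrow> \<epsilon>\<^sub>C Y = \<xi> Y \<cdot>\<^bsub>N\<^esub> farr H (\<epsilon> (fobj K Y))"
  by (simp add: conj_counit_def vcomp_def whisker_left_def whisker_right_def)

lemma functor_CK: "is_functor N M (C \<circ>\<^sub>F K)"
  by (rule is_functor_comp[OF adj.right.is_functor_axioms com.endo.is_functor_axioms])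

lemma functor_HC: "is_functor M N (H \<circ>\<^sub>F C)"
  by (rule is_functor_comp[OF com.endo.is_functor_axioms adj.left.is_functor_axioms])

lemma functor_conj: "is_functor N N C'"
  unfolding conj_ftor_def by (rule is_functor_comp[OF functor_CK adj.left.is_functor_axioms])

lemma nat_trans_conj_comult: "nat_trans N N C' (C' \<circ>\<^sub>F C') \<delta>\<^sub>C"
proof -
  have "nat_trans N N C' (H \<circ>\<^sub>F C \<circ>\<^sub>F C \<circ>\<^sub>F K) (whisker_left N H (whisker_right N \<delta> K))"
    using nat_trans_whisker_left[OF nat_trans_whisker_right[OF adj.right.is_functor_axioms
        com.comult.nat_trans_axioms] adj.left.is_functor_axioms]
    by (simp add: conj_ftor_def ftor_comp_assoc)
  moreover have "nat_trans N N (H \<circ>\<^sub>F C \<circ>\<^sub>F C \<circ>\<^sub>F K) (C' \<circ>\<^sub>F C')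
      (whisker_left N (H \<circ>\<^sub>F C) (whisker_right N \<eta> (C \<circ>\<^sub>F K)))"
    using nat_trans_whisker_left[OF nat_trans_whisker_right[OF functor_CK
        adj.unit.nat_trans_axioms] functor_HC]
    by (simp add: conj_ftor_def ftor_comp_assoc)
  ultimately show ?thesis
    unfolding conj_comult_def by (rule nat_trans_vcomp)
qed

lemma nat_trans_conj_counit: "nat_trans N N C' id_ftor \<epsilon>\<^sub>C"
proof -
  have "nat_trans N N C' (H \<circ>\<^sub>F K) (whisker_left N H (whisker_right N \<epsilon> K))"
    using nat_trans_whisker_left[OF nat_trans_whisker_right[OF adj.right.is_functor_axioms
        com.counit.nat_trans_axioms] adj.left.is_functor_axioms]
    by (simp add: conj_ftor_def)
  then show ?thesis
    unfolding conj_counit_def using adj.counit.nat_trans_axioms by (rule nat_trans_vcomp)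
qed

lemma coassoc_at:
  "X \<in> obj M \<Longrightarrow> \<delta> (fobj C X) \<cdot>\<^bsub>M\<^esub> \<delta> X = farr C (\<delta> X) \<cdot>\<^bsub>M\<^esub> \<delta> X"
  using fun_cong[OF com.coassoc, of X]
  by (simp add: vcomp_def whisker_left_def whisker_right_def)

lemma counit_left_at:
  "X \<in> obj M \<Longrightarrow> \<epsilon> (fobj C X) \<cdot>\<^bsub>M\<^esub> \<delta> X = ident M (fobj C X)"
  using fun_cong[OF com.counit_left, of X]
  by (simp add: vcomp_def whisker_right_def id_trans_def)

lemma counit_right_at:
  "X \<in> obj M \<Longrightarrow> farr C (\<epsilon> X) \<cdot>\<^bsub>M\<^esub> \<delta> X = ident M (fobj C X)"
  using fun_cong[OF com.counit_right, of X]
  by (simp add: vcomp_def whisker_left_def id_trans_def)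

lemma comult_natural:
  "f \<in> arrows M X Y \<Longrightarrow> farr C (farr C f) \<cdot>\<^bsub>M\<^esub> \<delta> X = \<delta> Y \<cdot>\<^bsub>M\<^esub> farr C f"
  using com.comult.natural by simp

lemma counit_natural:
  "f \<in> arrows M X Y \<Longrightarrow> f \<cdot>\<^bsub>M\<^esub> \<epsilon> X = \<epsilon> Y \<cdot>\<^bsub>M\<^esub> farr C f"
  using com.counit.natural by simp

text \<open>Moving the inner unit out by naturality reduces both sides to the same arrow composed with
  the two sides of the coassociativity law of \<open>C\<close>.\<close>

lemma pre_comult_coassoc:
  assumes [simp]: "Y \<in> obj N"
  shows "pre_comult (fobj C' Y) \<cdot>\<^bsub>M\<^esub> pre_comult Y
    = farr C (farr K (farr H (pre_comult Y))) \<cdot>\<^bsub>M\<^esub> pre_comult Y"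
proof -
  let ?X = "fobj K Y" and ?Z = "fobj C (fobj K (fobj C' Y))"
  let ?u = "\<eta> (fobj C ?X)"
  have u: "?u \<in> arrows M (fobj C ?X) (fobj K (fobj C' Y))"
    by (simp add: arrows_iff simps conj_ftor_def)
  have "pre_comult (fobj C' Y) \<cdot>\<^bsub>M\<^esub> pre_comult Y
      = farr C (\<eta> ?Z) \<cdot>\<^bsub>M\<^esub> (\<delta> (fobj K (fobj C' Y)) \<cdot>\<^bsub>M\<^esub> farr C ?u) \<cdot>\<^bsub>M\<^esub> \<delta> ?X"
    by (simp add: pre_comult_def simps conj_ftor_def)
  also have "\<dots> = farr C (\<eta> ?Z) \<cdot>\<^bsub>M\<^esub> farr C (farr C ?u) \<cdot>\<^bsub>M\<^esub> \<delta> (fobj C ?X) \<cdot>\<^bsub>M\<^esub> \<delta> ?X"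
    unfolding comult_natural[OF u, symmetric] by (simp add: simps conj_ftor_def)
  also have "\<dots> = farr C (\<eta> ?Z \<cdot>\<^bsub>M\<^esub> pre_comult Y) \<cdot>\<^bsub>M\<^esub> \<delta> ?X"
    by (simp add: coassoc_at pre_comult_def simps conj_ftor_def)
  also have "\<dots> = farr C (farr K (farr H (pre_comult Y)) \<cdot>\<^bsub>M\<^esub> ?u) \<cdot>\<^bsub>M\<^esub> \<delta> ?X"
    by (simp add: adj.unit_natural[OF pre_comult_arrow])
  also have "\<dots> = farr C (farr K (farr H (pre_comult Y))) \<cdot>\<^bsub>M\<^esub> pre_comult Y"
    by (simp add: pre_comult_def simps)
  finally show ?thesis .
qed

text \<open>In the left counit law \<open>\<epsilon>\<close> slides past \<open>C\<eta>\<close>, which leaves \<open>\<xi>H \<circ> H\<eta>\<close>; in the right counit law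
  \<open>KH\<epsilon>\<close> slides past \<open>\<eta>\<close>, which leaves \<open>K\<xi> \<circ> \<eta>K\<close>. Once the triangle identity has removed these,
  the counit laws of \<open>C\<close> remain.\<close>

theorem comonad_conj: "comonad N C' \<delta>\<^sub>C \<epsilon>\<^sub>C"
proof -
  interpret C': is_functor N N C' by (rule functor_conj)
  have C'_obj: "fobj C' Y = fobj H (fobj C (fobj K Y))" for Y by (simp add: conj_ftor_def)
  have C'_arr: "farr C' f = farr H (farr C (farr K f))" for f by (simp add: conj_ftor_def)
  have coassoc: "\<delta>\<^sub>C (fobj C' Y) \<cdot>\<^bsub>N\<^esub> \<delta>\<^sub>C Y = farr C' (\<delta>\<^sub>C Y) \<cdot>\<^bsub>N\<^esub> \<delta>\<^sub>C Y"
    if [simp]: "Y \<in> obj N" for Y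
  proof -
    note pre_comult_arrow[OF that, unfolded arrows_iff, simp]
      pre_comult_arrow[of "fobj C' Y", unfolded arrows_iff, simp]
    have "\<delta>\<^sub>C (fobj C' Y) \<cdot>\<^bsub>N\<^esub> \<delta>\<^sub>C Y
        = farr H (pre_comult (fobj C' Y) \<cdot>\<^bsub>M\<^esub> pre_comult Y)"
      by (simp add: conj_comult_at C'.fobj_obj adj.left.farr_cmp_arr)
    also have "\<dots> = farr C' (\<delta>\<^sub>C Y) \<cdot>\<^bsub>N\<^esub> \<delta>\<^sub>C Y"
      unfolding pre_comult_coassoc[OF that]
      by (simp add: conj_comult_at C'_arr C'_obj simps)
    finally show ?thesis .
  qed
  have counit_left: "\<epsilon>\<^sub>C (fobj C' Y) \<cdot>\<^bsub>N\<^esub> \<delta>\<^sub>C Y = ident N (fobj C' Y)"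
    if [simp]: "Y \<in> obj N" for Y
  proof -
    let ?X = "fobj K Y" and ?Z = "fobj K (fobj C' Y)"
    let ?u = "\<eta> (fobj C ?X)"
    have u: "?u \<in> arrows M (fobj C ?X) ?Z"
      by (simp add: arrows_iff simps C'_obj)
    have "\<epsilon>\<^sub>C (fobj C' Y) \<cdot>\<^bsub>N\<^esub> \<delta>\<^sub>C Y
        = \<xi> (fobj C' Y) \<cdot>\<^bsub>N\<^esub> farr H ((\<epsilon> ?Z \<cdot>\<^bsub>M\<^esub> farr C ?u) \<cdot>\<^bsub>M\<^esub> \<delta> ?X)"
      by (simp add: conj_counit_at conj_comult_at pre_comult_def C'_obj simps)
    also have "\<dots> = \<xi> (fobj C' Y) \<cdot>\<^bsub>N\<^esub> farr H (?u \<cdot>\<^bsub>M\<^esub> \<epsilon> (fobj C ?X) \<cdot>\<^bsub>M\<^esub> \<delta> ?X)"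
      unfolding counit_natural[OF u, symmetric] by (simp add: simps C'_obj)
    also have "\<dots> = ident N (fobj C' Y)"
      by (simp add: counit_left_at adj.triangle_left_at simps C'_obj)
    finally show ?thesis .
  qed
  have counit_right: "farr C' (\<epsilon>\<^sub>C Y) \<cdot>\<^bsub>N\<^esub> \<delta>\<^sub>C Y = ident N (fobj C' Y)"
    if [simp]: "Y \<in> obj N" for Y
  proof -
    let ?X = "fobj K Y"
    have e: "\<epsilon> ?X \<in> arrows M (fobj C ?X) ?X"
      by (simp add: arrows_iff simps)
    have "farr K (\<epsilon>\<^sub>C Y) \<cdot>\<^bsub>M\<^esub> \<eta> (fobj C ?X)
        = farr K (\<xi> Y) \<cdot>\<^bsub>M\<^esub> farr K (farr H (\<epsilon> ?X)) \<cdot>\<^bsub>M\<^esub> \<eta> (fobj C ?X)"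
      by (simp add: conj_counit_at simps)
    also have "\<dots> = (farr K (\<xi> Y) \<cdot>\<^bsub>M\<^esub> \<eta> ?X) \<cdot>\<^bsub>M\<^esub> \<epsilon> ?X"
      unfolding adj.unit_natural[OF e] by (simp add: simps)
    also have "\<dots> = \<epsilon> ?X"
      unfolding adj.triangle_right_at[OF that] by (simp add: simps)
    finally have *: "farr K (\<epsilon>\<^sub>C Y) \<cdot>\<^bsub>M\<^esub> \<eta> (fobj C ?X) = \<epsilon> ?X" .
    have "farr C' (\<epsilon>\<^sub>C Y) \<cdot>\<^bsub>N\<^esub> \<delta>\<^sub>C Y
        = farr H (farr C (farr K (\<epsilon>\<^sub>C Y) \<cdot>\<^bsub>M\<^esub> \<eta> (fobj C ?X)) \<cdot>\<^bsub>M\<^esub> \<delta> ?X)"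
      by (simp add: conj_comult_at conj_counit_at pre_comult_def C'_arr simps)
    also have "\<dots> = ident N (fobj C' Y)"
      unfolding * by (simp add: counit_right_at simps C'_obj)
    finally show ?thesis .
  qed
  show ?thesis
  proof (intro comonad.intro comonad_axioms.intro functor_conj nat_trans_conj_comult
      nat_trans_conj_counit)
    show "vcomp N N (whisker_right N \<delta>\<^sub>C C') \<delta>\<^sub>C = vcomp N N (whisker_left N C' \<delta>\<^sub>C) \<delta>\<^sub>C"
      unfolding vcomp_def whisker_left_def whisker_right_def
      by (rule restrict_ext) (simp add: coassoc)
    show "vcomp N N (whisker_right N \<epsilon>\<^sub>C C') \<delta>\<^sub>C = id_trans N N C'"
      unfolding vcomp_def whisker_right_def id_trans_def
      by (rule restrict_ext) (simp add: counit_left)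
    show "vcomp N N (whisker_left N C' \<epsilon>\<^sub>C) \<delta>\<^sub>C = id_trans N N C'"
      unfolding vcomp_def whisker_left_def id_trans_def
      by (rule restrict_ext) (simp add: counit_right)
  qed
qed

section \<open>Transferring colax structures to the conjugate comonad\<close>

text \<open>Writing \<open>\<sigma>'\<close> as the mate of \<open>\<sigma>\<close> and moving \<open>D\<xi>\<close> past \<open>\<epsilon>'\<close> or \<open>\<delta>'\<close> by naturality exposes the
  left-hand side of the corresponding colax equation of \<open>\<sigma>\<close> at \<open>KY\<close>.\<close>

theorem colax_morphism_conj:
  assumes \<sigma>': "nat_trans N N C' D \<sigma>'"
    and fact: "vcomp M N (whisker_right M \<sigma>' H) (conj_gamma M H \<eta> C) = \<sigma>"
    and "colax_morphism M C \<delta> \<epsilon> N D \<delta>' \<epsilon>' H \<sigma>"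
  shows "colax_morphism N C' \<delta>\<^sub>C \<epsilon>\<^sub>C N D \<delta>' \<epsilon>' id_ftor \<sigma>'"
proof -
  interpret s': nat_trans N N C' D \<sigma>' by fact
  interpret colax: colax_morphism M C \<delta> \<epsilon> N D \<delta>' \<epsilon>' H \<sigma> by fact
  note simps = simps s'.cod_functor.ftor_simps colax.target.comult.component_arr
    colax.target.counit.component_arr colax.trans.component_arr s'.component_arr
  have C'_obj: "fobj C' Y = fobj H (fobj C (fobj K Y))" for Y by (simp add: conj_ftor_def)
  have \<sigma>'_at: "\<sigma>' Y = farr D (\<xi> Y) \<cdot>\<^bsub>N\<^esub> \<sigma> (fobj K Y)" if "Y \<in> obj N" for Y
    using adj.mate_unique[OF functor_HC, of D \<sigma>' \<sigma>] \<sigma>' fact that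
    by (simp add: conj_gamma_def conj_ftor_def ftor_comp_assoc adj.mate_at)
  have fact_at: "\<sigma>' (fobj H X) \<cdot>\<^bsub>N\<^esub> farr H (farr C (\<eta> X)) = \<sigma> X" if "X \<in> obj M" for X
    using fun_cong[OF fact, of X] that
    by (simp add: conj_gamma_def vcomp_def whisker_left_def whisker_right_def)
  have counit: "\<epsilon>' Y \<cdot>\<^bsub>N\<^esub> \<sigma>' Y = \<epsilon>\<^sub>C Y" if [simp]: "Y \<in> obj N" for Y
  proof -
    let ?X = "fobj K Y"
    have "\<epsilon>' Y \<cdot>\<^bsub>N\<^esub> \<sigma>' Y = (\<epsilon>' Y \<cdot>\<^bsub>N\<^esub> farr D (\<xi> Y)) \<cdot>\<^bsub>N\<^esub> \<sigma> ?X"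
      by (simp add: \<sigma>'_at simps)
    also have "\<dots> = (\<xi> Y \<cdot>\<^bsub>N\<^esub> \<epsilon>' (fobj H ?X)) \<cdot>\<^bsub>N\<^esub> \<sigma> ?X"
      using colax.target.counit.natural_arr[of "\<xi> Y"] by (simp add: simps)
    also have "\<dots> = \<xi> Y \<cdot>\<^bsub>N\<^esub> \<epsilon>' (fobj H ?X) \<cdot>\<^bsub>N\<^esub> \<sigma> ?X"
      by (simp add: simps)
    also have "\<dots> = \<epsilon>\<^sub>C Y"
      using fun_cong[OF colax.counit_compat, of ?X]
      by (simp add: conj_counit_at vcomp_def whisker_left_def whisker_right_def simps)
    finally show ?thesis .
  qed
  have comult: "\<delta>' Y \<cdot>\<^bsub>N\<^esub> \<sigma>' Y = farr D (\<sigma>' Y) \<cdot>\<^bsub>N\<^esub> \<sigma>' (fobj C' Y) \<cdot>\<^bsub>N\<^esub> \<delta>\<^sub>C Y"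
    if [simp]: "Y \<in> obj N" for Y
  proof -
    let ?X = "fobj K Y"
    have "\<delta>' Y \<cdot>\<^bsub>N\<^esub> \<sigma>' Y = (\<delta>' Y \<cdot>\<^bsub>N\<^esub> farr D (\<xi> Y)) \<cdot>\<^bsub>N\<^esub> \<sigma> ?X"
      by (simp add: \<sigma>'_at simps)
    also have "\<dots> = (farr D (farr D (\<xi> Y)) \<cdot>\<^bsub>N\<^esub> \<delta>' (fobj H ?X)) \<cdot>\<^bsub>N\<^esub> \<sigma> ?X"
      using colax.target.comult.natural_arr[of "\<xi> Y"] by (simp add: simps)
    also have "\<dots> = farr D (farr D (\<xi> Y)) \<cdot>\<^bsub>N\<^esub> \<delta>' (fobj H ?X) \<cdot>\<^bsub>N\<^esub> \<sigma> ?X"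
      by (simp add: simps)
    also have "\<dots> = farr D (farr D (\<xi> Y)) \<cdot>\<^bsub>N\<^esub> farr D (\<sigma> ?X) \<cdot>\<^bsub>N\<^esub> \<sigma> (fobj C ?X) \<cdot>\<^bsub>N\<^esub> farr H (\<delta> ?X)"
      using fun_cong[OF colax.comult_compat, of ?X]
      by (simp add: vcomp_def whisker_left_def whisker_right_def simps)
    also have "\<dots> = farr D (\<sigma>' Y) \<cdot>\<^bsub>N\<^esub> \<sigma> (fobj C ?X) \<cdot>\<^bsub>N\<^esub> farr H (\<delta> ?X)"
      by (simp add: \<sigma>'_at simps)
    \<comment> \<open>Factoring \<open>\<sigma>\<close> through \<open>\<sigma>'\<close> at \<open>CKY\<close> produces exactly the unit that occurs in \<open>\<delta>\<^sub>C\<close>.\<close>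
    also have "\<dots> = farr D (\<sigma>' Y) \<cdot>\<^bsub>N\<^esub> (\<sigma>' (fobj C' Y) \<cdot>\<^bsub>N\<^esub> farr H (farr C (\<eta> (fobj C ?X))))
        \<cdot>\<^bsub>N\<^esub> farr H (\<delta> ?X)"
      using fact_at[of "fobj C ?X"] by (simp add: C'_obj simps)
    also have "\<dots> = farr D (\<sigma>' Y) \<cdot>\<^bsub>N\<^esub> \<sigma>' (fobj C' Y) \<cdot>\<^bsub>N\<^esub> \<delta>\<^sub>C Y"
      by (simp add: conj_comult_at pre_comult_def C'_obj simps)
    finally show ?thesis .
  qed
  show ?thesis
  proof (intro colax_morphism.intro colax_morphism_axioms.intro comonad_conj
      colax.target.comonad_axioms is_functor_id adj.left.target.category_axioms)
    show "nat_trans N N (id_ftor \<circ>\<^sub>F C') (D \<circ>\<^sub>F id_ftor) \<sigma>'"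
      using \<sigma>' by simp
    show "vcomp N N (whisker_right N \<delta>' id_ftor) \<sigma>' =
        vcomp N N (whisker_left N D \<sigma>')
          (vcomp N N (whisker_right N \<sigma>' C') (whisker_left N id_ftor \<delta>\<^sub>C))"
      unfolding vcomp_def whisker_left_def whisker_right_def
      by (rule restrict_ext) (simp add: comult)
    show "vcomp N N (whisker_right N \<epsilon>' id_ftor) \<sigma>' = whisker_left N id_ftor \<epsilon>\<^sub>C"
      unfolding vcomp_def whisker_left_def whisker_right_def
      by (rule restrict_ext) (simp add: counit)
  qed
qed

end

section \<open>The universal property\<close>

theorem proposition2p11:
  fixes M :: "('o, 'a) cat" and N :: "('p, 'b) cat"
    and H :: "('o, 'a, 'p, 'b) ftor" and K :: "('p, 'b, 'o, 'a) ftor"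
    and \<eta> :: "'o \<Rightarrow> 'a" and \<xi> :: "'p \<Rightarrow> 'b"
    and C :: "('o, 'a, 'o, 'a) ftor" and \<delta> \<epsilon> :: "'o \<Rightarrow> 'a"
    and D :: "('p, 'b, 'p, 'b) ftor" and \<sigma> :: "'o \<Rightarrow> 'b"
  assumes "adjunction M N H K \<eta> \<xi>"
    and "comonad M C \<delta> \<epsilon>"
    and "is_functor N N D"
    and "nat_trans M N (H \<circ>\<^sub>F C) (D \<circ>\<^sub>F H) \<sigma>"
  shows "(\<exists>!\<sigma>'. nat_trans N N (conj_ftor H K C) D \<sigma>' \<and>
            vcomp M N (whisker_right M \<sigma>' H) (conj_gamma M H \<eta> C) = \<sigma>) \<and>
         (\<forall>\<delta>' \<epsilon>' \<sigma>'.
            nat_trans N N (conj_ftor H K C) D \<sigma>' \<longrightarrow>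
            vcomp M N (whisker_right M \<sigma>' H) (conj_gamma M H \<eta> C) = \<sigma> \<longrightarrow>
            comonad N D \<delta>' \<epsilon>' \<longrightarrow>
            colax_morphism M C \<delta> \<epsilon> N D \<delta>' \<epsilon>' H \<sigma> \<longrightarrow>
            colax_morphism N (conj_ftor H K C) (conj_comult N H K \<eta> C \<delta>) (conj_counit N H K \<xi> \<epsilon>)
              N D \<delta>' \<epsilon>' id_ftor \<sigma>')"
proof -
  interpret adjunction_comonad M N H K \<eta> \<xi> C \<delta> \<epsilon>
    using assms(1,2) by (rule adjunction_comonad.intro)
  have HCK: "(H \<circ>\<^sub>F C) \<circ>\<^sub>F K = C'"
    by (simp add: conj_ftor_def ftor_comp_assoc)
  have "\<exists>!\<sigma>'. nat_trans N N C' D \<sigma>' \<and>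
      vcomp M N (whisker_right M \<sigma>' H) (conj_gamma M H \<eta> C) = \<sigma>"
  proof (rule ex1I, intro conjI)
    show "nat_trans N N C' D (adj.mate D N \<sigma>)"
      using adj.nat_trans_mate[OF assms(4,3)] by (simp add: HCK)
    show "vcomp M N (whisker_right M (adj.mate D N \<sigma>) H) (conj_gamma M H \<eta> C) = \<sigma>"
      using adj.mate_factorises[OF assms(4,3)] by (simp add: conj_gamma_def)
    show "\<sigma>' = adj.mate D N \<sigma>"
      if "nat_trans N N C' D \<sigma>' \<and>
        vcomp M N (whisker_right M \<sigma>' H) (conj_gamma M H \<eta> C) = \<sigma>" for \<sigma>'
      using that adj.mate_unique[OF functor_HC, of D \<sigma>' \<sigma>] by (simp add: HCK conj_gamma_def)
  qed
  then show ?thesis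
    using colax_morphism_conj by blast
qed

end
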